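(* Let $G$ be a subgroup of $S_{\mathbb N}$. The limit function of a Dirichlet series $\sum_{n=1}^\infty a_nn^{-s}\in\mathscr D_{\mathscr O_b}$ belongs to $\mathscr O_{b,G}$ if and only if (i) $a_n=0$ for all $n\in\mathbb N\setminus\mathbb N_{\mathbb O}$, and (ii) $a_{\hat\sigma(n)}=a_n$ for all $n\in\mathbb N_{\mathbb O}$ and $\sigma\in G$.
   Context: Let $\mathbb C_+=\{\mathrm{Re}\,s>0\}$. $\mathscr O_u$ is the algebra of holomorphic functions on $\mathbb C_+$ that are limits of Dirichlet series $\sum_{n\ge1} a_nn^{-s}$ converging uniformly on each half-plane $\{\mathrm{Re}\,s>\varepsilon\}$, $\varepsilon>0$ (the series is uniquely determined by the function). $\Omega(n)$ is the number of prime factors of $n$ counted with multiplicity; for $f\in\mathscr O_u$ with Dirichlet series $\sum a_nn^{-s}$ and $r\in(0,1)$, $f_r\in\mathscr O_u$ is the limit function of $\sum r^{\Omega(n)}a_nn^{-s}$. $\mathscr O_b$ is the algebra of all $f\in\mathscr O_u$ with $f_r$ bounded on $\mathbb C_+$ for every $r\in(0,1)$. $\mathscr D_{\mathscr O_b}$ is the set of Dirichlet series converging to functions in $\mathscr O_b$. $S_{\mathbb N}$ is the group of all permutations of $\mathbb N=\{1,2,\dots\}$; $p_1<p_2<\cdots$ are the primes, $\nu_p(n)$ the exponent of $p$ in $n$. For $\sigma\in S_{\mathbb N}$, $\hat\sigma(n)=\prod_ip_{\sigma(i)}^{\nu_{p_i}(n)}$, and $S_\sigma(\sum a_nn^{-s})=\sum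 a_{\hat\sigma^{-1}(n)}n^{-s}$. A function $f\in\mathscr O_b$ with Dirichlet series $D$ is $G$-invariant if $S_\sigma(D)=D$ for all $\sigma\in G$; $\mathscr O_{b,G}$ is the set of $G$-invariant elements of $\mathscr O_b$. $\mathbb O\subset\mathbb N$ is the union of all finite orbits of the action of $G$ on $\mathbb N$, and $\mathbb N_{\mathbb O}\subset\mathbb N$ is the multiplicative unital semigroup generated by all primes $p_i$ with $i\in\mathbb O$. *)

theory Defs
  imports
    "HOL-Complex_Analysis.Complex_Analysis"
    "HOL-Computational_Algebra.Computational_Algebra"
    "HOL-Algebra.Group_Action"
begin

text \<open>
  Throughout, the positive integers are the set \<open>{1..}\<close> of type \<^typ>\<open>nat set\<close>, and a
  Dirichlet series is given by its coefficients \<open>a :: nat \<Rightarrow> complex\<close>; the value \<open>a 0\<close>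
  is never used. Holomorphic functions on the right half-plane are total functions whose values
  outside the half-plane are irrelevant.
\<close>

definition half_plane :: "real \<Rightarrow> complex set"
  where "half_plane \<epsilon> = {s. Re s > \<epsilon>}"

definition dirichlet_partial_sum :: "(nat \<Rightarrow> complex) \<Rightarrow> nat \<Rightarrow> complex \<Rightarrow> complex"
  where "dirichlet_partial_sum a N s = (\<Sum>n=1..N. a n * of_nat n powr (- s))"

text \<open>\<open>f\<close> is the limit function in \<open>\<O>\<^sub>u\<close> of the Dirichlet series \<open>a\<close>.\<close>
definition is_limit_function :: "(nat \<Rightarrow> complex) \<Rightarrow> (complex \<Rightarrow> complex) \<Rightarrow> bool"
  where "is_limit_function a f \<longleftrightarrow>
    f holomorphic_on half_plane 0 \<and>
    (\<forall>\<epsilon>>0. uniform_limit (half_plane \<epsilon>) (dirichlet_partial_sum a) f sequentially)"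

definition O_u :: "(complex \<Rightarrow> complex) set"
  where "O_u = {f. \<exists>a. is_limit_function a f}"

definition Omega_count :: "nat \<Rightarrow> nat"
  where "Omega_count n = size (prime_factorization n)"

definition radial_coeffs :: "real \<Rightarrow> (nat \<Rightarrow> complex) \<Rightarrow> nat \<Rightarrow> complex"
  where "radial_coeffs r a n = of_real (r ^ Omega_count n) * a n"

text \<open>
  The coefficients \<open>a\<^sub>n\<close>, \<open>n \<ge> 1\<close>, are uniquely determined by \<open>f\<close>, so the existential
  quantifier over \<open>a\<close> just names the Dirichlet series of \<open>f\<close>; likewise \<open>g\<close> is the
  function \<open>f\<^sub>r\<close>, determined on the half-plane and itself an element of \<open>\<O>\<^sub>u\<close>.
\<close>
definition O_b :: "(complex \<Rightarrow> complex) set"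
  where "O_b = {f \<in> O_u. \<exists>a. is_limit_function a f \<and>
    (\<forall>r\<in>{0<..<1}. \<exists>g\<in>O_u. is_limit_function (radial_coeffs r a) g \<and>
        bounded (g ` half_plane 0))}"

definition D_O_b :: "(nat \<Rightarrow> complex) set"
  where "D_O_b = {a. \<exists>f\<in>O_b. is_limit_function a f}"

text \<open>Numbered from 1, so that \<open>nth_prime 1 = 2\<close>.\<close>
definition nth_prime :: "nat \<Rightarrow> nat"
  where "nth_prime i = enumerate {p. Factorial_Ring.prime p} (i - 1)"

abbreviation S_N :: "(nat \<Rightarrow> nat) monoid"
  where "S_N \<equiv> BijGroup {1..}"

text \<open>
  The product over all \<open>i \<ge> 1\<close> is restricted to the finitely many indices with
  nonzero exponent.
\<close>
definition hat_perm :: "(nat \<Rightarrow> nat) \<Rightarrow> nat \<Rightarrow> nat"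
  where "hat_perm \<sigma> n =
    (\<Prod>i\<in>{i. i \<ge> 1 \<and> multiplicity (nth_prime i) n \<noteq> 0}.
        nth_prime (\<sigma> i) ^ multiplicity (nth_prime i) n)"

definition S_perm :: "(nat \<Rightarrow> nat) \<Rightarrow> (nat \<Rightarrow> complex) \<Rightarrow> nat \<Rightarrow> complex"
  where "S_perm \<sigma> a n = a (inv_into {1..} (hat_perm \<sigma>) n)"

text \<open>As above, \<open>a\<close> is the Dirichlet series of \<open>f\<close>.\<close>
definition O_b_inv :: "(nat \<Rightarrow> nat) set \<Rightarrow> (complex \<Rightarrow> complex) set"
  where "O_b_inv G = {f \<in> O_b. \<exists>a. is_limit_function a f \<and>
    (\<forall>\<sigma>\<in>G. \<forall>n\<ge>1. S_perm \<sigma> a n = a n)}"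

definition finite_orbit_points :: "(nat \<Rightarrow> nat) set \<Rightarrow> nat set"
  where "finite_orbit_points G =
    \<Union> {X \<in> orbits (S_N\<lparr>carrier := G\<rparr>) {1..} (\<lambda>\<sigma>. \<sigma>). finite X}"

inductive_set unital_semigroup_gen :: "nat set \<Rightarrow> nat set" for X :: "nat set"
  where
    one: "1 \<in> unital_semigroup_gen X"
  | gen: "x \<in> X \<Longrightarrow> x \<in> unital_semigroup_gen X"
  | mult: "x \<in> unital_semigroup_gen X \<Longrightarrow> y \<in> unital_semigroup_gen X \<Longrightarrow>
      x * y \<in> unital_semigroup_gen X"

definition N_O :: "(nat \<Rightarrow> nat) set \<Rightarrow> nat set"
  where "N_O G = unital_semigroup_gen (nth_prime ` finite_orbit_points G)"

end

theory Submission
  imports Defs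
begin

text \<open>
  Invariance under \<open>\<sigma>\<close> amounts to \<open>a (hat_perm \<sigma> n) = a n\<close> for all \<open>n \<ge> 1\<close>: the coefficients of a
  function in \<open>\<O>\<^sub>u\<close> are unique (\<open>is_limit_function_unique_coeffs\<close>), and \<open>hat_perm \<sigma>\<close> is a permutation
  of the positive integers (\<open>bij_betw_hat_perm\<close>). The set \<open>N_O G\<close> is stable under these permutations
  and so is its complement (\<open>hat_perm_in_N_O_iff\<close>); hence conditions (i) and (ii) together imply
  invariance.

  Conversely, suppose that \<open>f\<close> is invariant and that \<open>n\<close> is outside \<open>N_O G\<close>. Then \<open>n\<close> has a prime
  factor whose index has an infinite orbit, so \<open>n\<close> itself has infinitely many images
  \<open>hat_perm \<sigma> n\<close> (\<open>infinite_hat_orbit\<close>). All of them have the same \<open>\<Omega>\<close> as \<open>n\<close>, so that the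
  coefficient \<open>r\<^sup>\<Omega>\<^sup>(\<^sup>n\<^sup>) a\<^sub>n\<close> of the bounded function \<open>f\<^sub>r\<close> is repeated infinitely often. But the
  coefficients of a bounded function in \<open>\<O>\<^sub>u\<close> are square summable (\<open>dirichlet_series_bessel\<close>), which
  forces \<open>a\<^sub>n = 0\<close> (\<open>invariant_coeff_eq_0\<close>).

  The Bessel inequality rests on almost periodicity. Instead of integrating over vertical
  lines, it averages over an arithmetic progression of points on the line: with a small step
  \<open>h\<close> the numbers \<open>n\<^sup>-\<^sup>i\<^sup>h\<close> for \<open>n \<le> N\<close> are distinct points of the unit circle, and the averages of the
  powers of a point \<open>w \<noteq> 1\<close> of the circle tend to \<open>0\<close>. The same inequality with bound \<open>0\<close> gives the
  uniqueness of the coefficients.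
\<close>

section \<open>A Bessel inequality for bounded Dirichlet series\<close>

text \<open>
  This plays the role of the orthogonality relation for characters: for \<open>w \<noteq> 1\<close> the geometric sums
  stay below \<open>2 / \<bar>1 - w\<bar>\<close>.
\<close>

lemma averaged_powers_tendsto:
  fixes w :: complex
  assumes "cmod w = 1"
  shows "(\<lambda>T. (\<Sum>k<T. w ^ k) / of_nat T) \<longlonglongrightarrow> (if w = 1 then 1 else 0)"
proof (cases "w = 1")
  case True
  have "\<forall>\<^sub>F T in sequentially. (\<Sum>k<T. w ^ k) / of_nat T = 1"
    using eventually_gt_at_top[of 0] by eventually_elim (simp add: True)
  then show ?thesis
    by (simp add: True tendsto_eventually)
next
  case False
  have "(\<lambda>T. (\<Sum>k<T. w ^ k) / of_nat T) \<longlonglongrightarrow> 0"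
  proof (rule Lim_null_comparison)
    show "\<forall>\<^sub>F T in sequentially.
        norm ((\<Sum>k<T. w ^ k) / of_nat T) \<le> (2 / cmod (1 - w)) * (1 / real T)"
    proof (intro always_eventually allI)
      fix T
      have "cmod (1 - w ^ T) \<le> 2"
        using norm_triangle_ineq4[of 1 "w ^ T"] by (simp add: norm_power assms)
      then have "cmod (\<Sum>k<T. w ^ k) \<le> 2 / cmod (1 - w)"
        by (simp add: sum_gp_strict False norm_divide divide_right_mono)
      then show "norm ((\<Sum>k<T. w ^ k) / of_nat T) \<le> (2 / cmod (1 - w)) * (1 / real T)"
        using divide_right_mono[of "cmod (\<Sum>k<T. w ^ k)" "2 / cmod (1 - w)" "real T"]
        by (simp add: norm_divide)
    qed
    show "(\<lambda>T. (2 / cmod (1 - w)) * (1 / real T)) \<longlonglongrightarrow> 0"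
      by (rule tendsto_mult_right_zero[OF lim_1_over_n])
  qed
  then show ?thesis by (simp add: False)
qed

text \<open>
  Averaging \<open>\<bar>\<Sum>j. c\<^sub>j z\<^sub>j\<^sup>k\<bar>\<^sup>2\<close> over \<open>k\<close> kills the mixed terms: those are multiples of
  \<open>(z\<^sub>i * cnj z\<^sub>j)\<^sup>k\<close>, and \<open>z\<^sub>i * cnj z\<^sub>j = 1\<close> only on the diagonal.
\<close>

lemma sum_norm_squares_le_of_bounded_power_sums:
  fixes c z :: "'i \<Rightarrow> complex"
  assumes "finite A" and inj: "inj_on z A" and unimodular: "\<And>j. j \<in> A \<Longrightarrow> cmod (z j) = 1"
    and bound: "\<And>k::nat. cmod (\<Sum>j\<in>A. c j * z j ^ k) \<le> K"
  shows "(\<Sum>j\<in>A. (cmod (c j))\<^sup>2) \<le> K\<^sup>2"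
proof -
  define P where "P k = (\<Sum>j\<in>A. c j * z j ^ k)" for k
  have expand: "complex_of_real ((cmod (P k))\<^sup>2) =
      (\<Sum>i\<in>A. \<Sum>j\<in>A. c i * cnj (c j) * (z i * cnj (z j)) ^ k)" for k
    unfolding complex_norm_square P_def cnj_sum sum_product
    by (intro sum.cong refl) (simp add: power_mult_distrib mult_ac)
  have unit: "z i * cnj (z j) = 1 \<longleftrightarrow> i = j" if "i \<in> A" "j \<in> A" for i j
  proof -
    have self: "z j * cnj (z j) = 1"
      using unimodular[OF that(2)] complex_norm_square[of "z j"] by simp
    then have "cnj (z j) \<noteq> 0" by auto
    then have "z i * cnj (z j) = 1 \<longleftrightarrow> z i = z j"
      using self by (metis mult_right_cancel)
    then show ?thesis using inj that by (auto dest: inj_onD)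
  qed
  have "(\<lambda>T. \<Sum>i\<in>A. \<Sum>j\<in>A. c i * cnj (c j) * ((\<Sum>k<T. (z i * cnj (z j)) ^ k) / of_nat T))
      \<longlonglongrightarrow> (\<Sum>i\<in>A. \<Sum>j\<in>A. c i * cnj (c j) * (if z i * cnj (z j) = 1 then 1 else 0))"
    by (intro tendsto_sum tendsto_mult_left averaged_powers_tendsto)
       (simp add: norm_mult unimodular)
  also have "(\<lambda>T. \<Sum>i\<in>A. \<Sum>j\<in>A. c i * cnj (c j) * ((\<Sum>k<T. (z i * cnj (z j)) ^ k) / of_nat T))
      = (\<lambda>T. complex_of_real ((\<Sum>k<T. (cmod (P k))\<^sup>2) / real T))"
  proof
    fix T
    have "complex_of_real ((\<Sum>k<T. (cmod (P k))\<^sup>2) / real T) =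
        (\<Sum>k<T. \<Sum>i\<in>A. \<Sum>j\<in>A. c i * cnj (c j) * (z i * cnj (z j)) ^ k) / of_nat T"
      by (simp only: of_real_divide of_real_sum expand of_real_of_nat_eq)
    also have "\<dots> = (\<Sum>i\<in>A. \<Sum>j\<in>A. \<Sum>k<T. c i * cnj (c j) * (z i * cnj (z j)) ^ k) / of_nat T"
      by (subst sum.swap, subst sum.swap) (rule refl)
    finally show "(\<Sum>i\<in>A. \<Sum>j\<in>A. c i * cnj (c j) * ((\<Sum>k<T. (z i * cnj (z j)) ^ k) / of_nat T))
      = complex_of_real ((\<Sum>k<T. (cmod (P k))\<^sup>2) / real T)"
      by (simp add: sum_divide_distrib sum_distrib_left)
  qed
  also have "(\<Sum>i\<in>A. \<Sum>j\<in>A. c i * cnj (c j) * (if z i * cnj (z j) = 1 then 1 else 0))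
      = (\<Sum>i\<in>A. \<Sum>j\<in>A. if i = j then c i * cnj (c j) else 0)"
    by (intro sum.cong refl) (simp add: unit)
  also have "\<dots> = complex_of_real (\<Sum>i\<in>A. (cmod (c i))\<^sup>2)"
    using \<open>finite A\<close> by (simp only: sum.delta' sum.delta of_real_sum complex_norm_square) (simp cong: sum.cong)
  finally have lim: "(\<lambda>T. (\<Sum>k<T. (cmod (P k))\<^sup>2) / real T) \<longlonglongrightarrow> (\<Sum>i\<in>A. (cmod (c i))\<^sup>2)"
    by (simp only: tendsto_of_real_iff)
  show ?thesis
  proof (rule LIMSEQ_le_const2[OF lim], intro exI allI impI)
    fix T :: nat assume "1 \<le> T"
    have "(\<Sum>k<T. (cmod (P k))\<^sup>2) \<le> (\<Sum>k<T. K\<^sup>2)"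
      unfolding P_def by (intro sum_mono power_mono bound) simp
    then show "(\<Sum>k<T. (cmod (P k))\<^sup>2) / real T \<le> K\<^sup>2"
      using \<open>1 \<le> T\<close> by (simp add: field_simps)
  qed
qed

text \<open>
  Sampling the line \<open>Re s = \<epsilon>\<close> at the points \<open>\<epsilon> + i k h\<close> turns the polynomial into a sum of powers of
  \<open>n\<^sup>-\<^sup>i\<^sup>h\<close>, to which the preceding lemma applies.
\<close>

lemma dirichlet_polynomial_bessel:
  assumes bound: "\<And>t. cmod (dirichlet_partial_sum b N (Complex \<epsilon> t)) \<le> K"
  shows "(\<Sum>n=1..N. (cmod (b n) * real n powr (- \<epsilon>))\<^sup>2) \<le> K\<^sup>2"
proof -
  \<comment> \<open>The step is so small that the angles \<open>h * ln n\<close> stay in \<open>[0, 1]\<close>, within one period of \<open>exp\<close>.\<close>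
  define h where "h = 1 / (1 + ln (real (max 1 N)))"
  have h: "h > 0"
    unfolding h_def by (intro divide_pos_pos add_pos_nonneg) auto
  have small: "0 \<le> h * ln (real n) \<and> h * ln (real n) \<le> 1" if "n \<in> {1..N}" for n
  proof -
    have "0 \<le> ln (real n)" "ln (real n) \<le> ln (real (max 1 N))" using that by auto
    then show ?thesis unfolding h_def by (simp add: field_simps)
  qed
  define z where "z n = exp (- (\<i> * of_real (h * ln (real n))))" for n :: nat
  define c where "c n = b n * of_real (real n powr (- \<epsilon>))" for n
  have "inj_on z {1..N}"
  proof (rule inj_onI)
    fix m n assume mn: "m \<in> {1..N}" "n \<in> {1..N}" "z m = z n"
    have "- (\<i> * complex_of_real (h * ln (real m))) = - (\<i> * complex_of_real (h * ln (real n)))"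
    proof (rule exp_complex_eqI)
      show "\<bar>Im (- (\<i> * of_real (h * ln (real m)))) - Im (- (\<i> * of_real (h * ln (real n))))\<bar> < 2 * pi"
        using small[OF mn(1)] small[OF mn(2)] pi_gt3 by (simp add: abs_less_iff)
    qed (use mn(3) in \<open>simp add: z_def\<close>)
    then have "h * ln (real m) = h * ln (real n)"
      by (metis Im_i_times Re_complex_of_real neg_equal_iff_equal)
    with h mn show "m = n" by simp
  qed
  moreover have "cmod (z n) = 1" for n
    by (simp add: z_def norm_exp_eq_Re)
  moreover have "cmod (\<Sum>n\<in>{1..N}. c n * z n ^ k) \<le> K" for k :: nat
  proof -
    have "(\<Sum>n\<in>{1..N}. c n * z n ^ k) = dirichlet_partial_sum b N (Complex \<epsilon> (real k * h))"
      unfolding dirichlet_partial_sum_def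
    proof (intro sum.cong refl)
      fix n assume "n \<in> {1..N}"
      then have n: "n > 0" by simp
      have "complex_of_nat n powr (- Complex \<epsilon> (real k * h)) =
          exp (of_real (- \<epsilon> * ln (real n)) + of_nat k * (- (\<i> * of_real (h * ln (real n)))))"
        using n by (simp add: powr_def Ln_of_nat Complex_eq algebra_simps)
      also have "\<dots> = of_real (real n powr (- \<epsilon>)) * z n ^ k"
        unfolding exp_add exp_of_nat_mult z_def using n by (simp add: powr_def flip: exp_of_real)
      finally show "c n * z n ^ k = b n * complex_of_nat n powr (- Complex \<epsilon> (real k * h))"
        by (simp add: c_def)
    qed
    with bound show ?thesis by simp
  qed
  ultimately have "(\<Sum>n\<in>{1..N}. (cmod (c n))\<^sup>2) \<le> K\<^sup>2"
    by (intro sum_norm_squares_le_of_bounded_power_sums) auto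
  then show ?thesis by (simp add: c_def norm_mult)
qed

text \<open>
  On a fixed line \<open>Re s = \<epsilon>\<close> the long partial sums are bounded by \<open>M + \<delta>\<close>, which gives the inequality
  with weights \<open>n\<^sup>-\<^sup>\<epsilon>\<close>. For a finite index set the weights tend to \<open>1\<close> as \<open>\<epsilon>\<close> tends to \<open>0\<close>; \<open>\<delta>\<close>
  is sent to \<open>0\<close> at the same time.
\<close>

lemma dirichlet_series_bessel:
  assumes lim: "is_limit_function b g"
    and bound: "\<And>s. s \<in> half_plane 0 \<Longrightarrow> cmod (g s) \<le> M"
    and F: "finite F" "F \<subseteq> {1..}"
  shows "(\<Sum>n\<in>F. (cmod (b n))\<^sup>2) \<le> M\<^sup>2"
proof -
  have with_weights: "(\<Sum>n\<in>F. (cmod (b n) * real n powr (- \<epsilon>))\<^sup>2) \<le> (M + \<delta>)\<^sup>2"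
    if "\<epsilon> > 0" "\<delta> > 0" for \<epsilon> \<delta>
  proof -
    have "uniform_limit (half_plane (\<epsilon> / 2)) (dirichlet_partial_sum b) g sequentially"
      using lim that by (simp add: is_limit_function_def)
    then have "\<forall>\<^sub>F N in sequentially.
        \<forall>s\<in>half_plane (\<epsilon> / 2). dist (dirichlet_partial_sum b N s) (g s) < \<delta>"
      using that by (simp add: uniform_limit_iff)
    then obtain N0 where N0: "\<And>N s. N \<ge> N0 \<Longrightarrow> s \<in> half_plane (\<epsilon> / 2) \<Longrightarrow>
        dist (dirichlet_partial_sum b N s) (g s) < \<delta>"
      by (auto simp: eventually_sequentially)
    define N where "N = max N0 (Max (insert 0 F))"
    have N: "N \<ge> N0" "F \<subseteq> {1..N}"
      using F by (auto simp: N_def le_max_iff_disj)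
    have "cmod (dirichlet_partial_sum b N (Complex \<epsilon> t)) \<le> M + \<delta>" for t
    proof -
      have "Complex \<epsilon> t \<in> half_plane (\<epsilon> / 2)" "Complex \<epsilon> t \<in> half_plane 0"
        using that by (simp_all add: half_plane_def)
      then show ?thesis
        using N0[OF N(1), of "Complex \<epsilon> t"] bound[of "Complex \<epsilon> t"]
          norm_triangle_sub[of "dirichlet_partial_sum b N (Complex \<epsilon> t)" "g (Complex \<epsilon> t)"]
        by (simp add: dist_norm)
    qed
    then have "(\<Sum>n=1..N. (cmod (b n) * real n powr (- \<epsilon>))\<^sup>2) \<le> (M + \<delta>)\<^sup>2"
      by (rule dirichlet_polynomial_bessel)
    moreover have "(\<Sum>n\<in>F. (cmod (b n) * real n powr (- \<epsilon>))\<^sup>2) \<le>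
        (\<Sum>n=1..N. (cmod (b n) * real n powr (- \<epsilon>))\<^sup>2)"
      using N by (intro sum_mono2) auto
    ultimately show ?thesis by linarith
  qed
  have left: "((\<lambda>\<epsilon>. \<Sum>n\<in>F. (cmod (b n) * real n powr (- \<epsilon>))\<^sup>2) \<longlongrightarrow>
      (\<Sum>n\<in>F. (cmod (b n) * real n powr (- 0))\<^sup>2)) (at_right 0)"
    using F by (intro tendsto_intros) auto
  have right: "((\<lambda>\<epsilon>. (M + \<epsilon>)\<^sup>2) \<longlongrightarrow> (M + 0)\<^sup>2) (at_right 0)"
    by (intro tendsto_intros)
  have "(\<Sum>n\<in>F. (cmod (b n) * real n powr (- 0))\<^sup>2) \<le> (M + 0)\<^sup>2"
    using with_weights eventually_at_right_less[of "0::real"]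
    by (intro tendsto_le[OF _ right left]) (auto elim: eventually_mono)
  moreover have "(\<Sum>n\<in>F. (cmod (b n) * real n powr (- 0))\<^sup>2) = (\<Sum>n\<in>F. (cmod (b n))\<^sup>2)"
    using F by (intro sum.cong refl) auto
  ultimately show ?thesis by simp
qed

text \<open>
  The differences of the coefficients form a Dirichlet series with limit function \<open>0\<close>, so the
  Bessel inequality holds for them with bound \<open>0\<close>.
\<close>

lemma is_limit_function_unique_coeffs:
  assumes "is_limit_function a f" "is_limit_function b f" "n \<ge> 1"
  shows "a n = b n"
proof -
  have "is_limit_function (\<lambda>n. a n - b n) (\<lambda>s. 0)"
    unfolding is_limit_function_def
  proof (intro conjI allI impI)
    fix \<epsilon> :: real assume "\<epsilon> > 0"
    then have "uniform_limit (half_plane \<epsilon>)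
        (\<lambda>N s. dirichlet_partial_sum a N s - dirichlet_partial_sum b N s) (\<lambda>s. f s - f s) sequentially"
      using assms by (intro uniform_limit_minus) (auto simp: is_limit_function_def)
    then show "uniform_limit (half_plane \<epsilon>) (dirichlet_partial_sum (\<lambda>n. a n - b n)) (\<lambda>s. 0) sequentially"
      by (simp add: dirichlet_partial_sum_def[abs_def] sum_subtractf left_diff_distrib)
  qed simp
  from dirichlet_series_bessel[OF this, of 0 "{n}"] show ?thesis
    using assms(3) by simp
qed

lemma is_limit_function_cong:
  assumes "\<And>n. n \<ge> 1 \<Longrightarrow> a n = b n"
  shows "is_limit_function a f \<longleftrightarrow> is_limit_function b f"
proof -
  have "dirichlet_partial_sum a = dirichlet_partial_sum b"
    using assms by (intro ext) (simp add: dirichlet_partial_sum_def)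
  then show ?thesis by (simp add: is_limit_function_def)
qed

text \<open>
  The definition of \<open>\<O>\<^sub>b\<close> provides some coefficient sequence of \<open>f\<close> with bounded \<open>f\<^sub>r\<close>; by uniqueness
  it may be replaced by any given one.
\<close>

lemma O_b_radial_bounded:
  assumes "f \<in> O_b" "is_limit_function a f" "0 < r" "r < 1"
  obtains g where "g \<in> O_u" "is_limit_function (radial_coeffs r a) g" "bounded (g ` half_plane 0)"
proof -
  from assms obtain b g where b: "is_limit_function b f" and g: "g \<in> O_u"
      "is_limit_function (radial_coeffs r b) g" "bounded (g ` half_plane 0)"
    unfolding O_b_def by fastforce
  have "is_limit_function (radial_coeffs r a) g \<longleftrightarrow> is_limit_function (radial_coeffs r b) g"
    using is_limit_function_unique_coeffs[OF assms(2) b]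
    by (intro is_limit_function_cong) (simp add: radial_coeffs_def)
  with g that show ?thesis by blast
qed

text \<open>
  Membership in \<open>D_O_b\<close> speaks of some limit function of the series, which may differ from \<open>f\<close> off the
  half-plane; membership in \<open>O_b\<close> depends only on the coefficients, hence passes to \<open>f\<close>.
\<close>

lemma limit_function_of_D_O_b_in_O_b:
  assumes "a \<in> D_O_b" "is_limit_function a f"
  shows "f \<in> O_b"
proof -
  from assms(1) obtain f' where f': "f' \<in> O_b" "is_limit_function a f'"
    by (auto simp: D_O_b_def)
  then show ?thesis
    using assms(2) O_b_radial_bounded[OF f'] unfolding O_b_def O_u_def
    by (auto intro!: exI[of _ a]) metis
qed

section \<open>Index permutations acting on integers\<close>

lemma bij_betw_nth_prime: "bij_betw nth_prime {1..} {p. Factorial_Ring.prime p}"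
proof -
  have "bij_betw (\<lambda>i::nat. i - 1) {1..} UNIV"
    by (rule bij_betwI[where g = Suc]) auto
  from bij_betw_trans[OF this bij_enumerate[OF primes_infinite]]
  show ?thesis by (simp add: nth_prime_def[abs_def] o_def)
qed

lemma prime_nth_prime: "i \<ge> 1 \<Longrightarrow> Factorial_Ring.prime (nth_prime i)"
  using bij_betwE[OF bij_betw_nth_prime] by auto

lemma nth_prime_neq_0: "i \<ge> 1 \<Longrightarrow> nth_prime i \<noteq> 0"
  using prime_nth_prime[of i] by (metis not_prime_0)

lemma nth_prime_eq_iff: "i \<ge> 1 \<Longrightarrow> j \<ge> 1 \<Longrightarrow> nth_prime i = nth_prime j \<longleftrightarrow> i = j"
  using bij_betw_imp_inj_on[OF bij_betw_nth_prime] by (auto dest: inj_onD)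

lemma prime_eq_nth_prime:
  assumes "Factorial_Ring.prime (p::nat)"
  obtains i where "i \<ge> 1" "p = nth_prime i"
  using bij_betw_imp_surj_on[OF bij_betw_nth_prime] assms by (metis atLeast_iff imageE mem_Collect_eq)

lemma multiplicity_nth_prime_neq_0_iff:
  assumes "i \<ge> 1" "n \<ge> 1"
  shows "multiplicity (nth_prime i) n \<noteq> 0 \<longleftrightarrow> nth_prime i dvd n"
proof -
  have "multiplicity (nth_prime i) n > 0 \<longleftrightarrow> nth_prime i dvd n"
    using prime_nth_prime[OF assms(1)] assms(2)
    by (intro multiplicity_gt_zero_iff) (auto dest: not_prime_unit)
  then show ?thesis by simp
qed

lemma finite_prime_index_support: "finite {i. i \<ge> 1 \<and> multiplicity (nth_prime i) n \<noteq> 0}"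
proof (cases "n = 0")
  case False
  let ?I = "{i. i \<ge> 1 \<and> multiplicity (nth_prime i) n \<noteq> 0}"
  have "nth_prime ` ?I \<subseteq> {d. d dvd n}"
    using multiplicity_nth_prime_neq_0_iff False by auto
  moreover have "inj_on nth_prime ?I"
    by (auto intro!: inj_onI simp: nth_prime_eq_iff)
  ultimately show ?thesis
    using finite_divisors_nat False by (metis finite_imageD finite_subset not_gr_zero)
qed simp

lemma eq_if_prime_multiplicities_eq:
  assumes "m \<ge> 1" "n \<ge> 1"
    and "\<And>i. i \<ge> 1 \<Longrightarrow> multiplicity (nth_prime i) m = multiplicity (nth_prime i) n"
  shows "m = n"
proof (rule multiplicity_eq_nat)
  fix p :: nat assume "Factorial_Ring.prime p"
  then obtain i where "i \<ge> 1" "p = nth_prime i" by (rule prime_eq_nth_prime)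
  with assms(3) show "multiplicity p m = multiplicity p n" by simp
qed (use assms in auto)

lemma hat_perm_ge_1:
  assumes "bij_betw \<sigma> {1..} {1..}"
  shows "hat_perm \<sigma> n \<ge> 1"
proof -
  have "\<sigma> i \<ge> 1" if "i \<ge> 1" for i
    using bij_betwE[OF assms] that by auto
  then have "hat_perm \<sigma> n > 0"
    unfolding hat_perm_def by (intro prod_pos) (auto intro!: prime_gt_0_nat prime_nth_prime)
  then show ?thesis by simp
qed

text \<open>
  This determines \<open>hat_perm \<sigma> n\<close>, as \<open>\<sigma>\<close> reaches every index; most facts about \<open>hat_perm\<close> are read
  off from it.
\<close>

lemma multiplicity_hat_perm:
  assumes bij: "bij_betw \<sigma> {1..} {1..}" and i: "i \<ge> 1"
  shows "multiplicity (nth_prime (\<sigma> i)) (hat_perm \<sigma> n) = multiplicity (nth_prime i) n"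
proof -
  let ?I = "{i. i \<ge> 1 \<and> multiplicity (nth_prime i) n \<noteq> 0}"
  let ?m = "\<lambda>i. multiplicity (nth_prime i) n"
  have pos: "\<sigma> j \<ge> 1" if "j \<ge> 1" for j
    using bij_betwE[OF bij] that by auto
  have "multiplicity (nth_prime (\<sigma> i)) (hat_perm \<sigma> n) =
      (\<Sum>j\<in>?I. multiplicity (nth_prime (\<sigma> i)) (nth_prime (\<sigma> j) ^ ?m j))"
    unfolding hat_perm_def
  proof (rule prime_elem_multiplicity_prod_distrib)
    show "0 \<notin> (\<lambda>j. nth_prime (\<sigma> j) ^ ?m j) ` ?I"
      using nth_prime_neq_0[OF pos] by (force simp del: neq0_conv)
  qed (use finite_prime_index_support pos i in \<open>auto intro: prime_imp_prime_elem prime_nth_prime\<close>)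
  also have "\<dots> = (\<Sum>j\<in>?I. if j = i then ?m j else 0)"
  proof (intro sum.cong refl)
    fix j assume "j \<in> ?I"
    then have j: "j \<ge> 1" by simp
    show "multiplicity (nth_prime (\<sigma> i)) (nth_prime (\<sigma> j) ^ ?m j) = (if j = i then ?m j else 0)"
    proof (cases "j = i")
      case True
      have "nth_prime (\<sigma> i) \<noteq> 0" "\<not> is_unit (nth_prime (\<sigma> i))"
        using prime_nth_prime[OF pos[OF i]] by (auto simp: not_prime_unit)
      with True show ?thesis by (simp add: multiplicity_same_power)
    next
      case False
      have "\<sigma> i \<noteq> \<sigma> j"
        using bij_betw_imp_inj_on[OF bij] i j False by (auto dest: inj_onD)
      then have "nth_prime (\<sigma> i) \<noteq> nth_prime (\<sigma> j)"
        using nth_prime_eq_iff[OF pos[OF i] pos[OF j]] by simp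
      with False show ?thesis
        using multiplicity_distinct_prime_power[OF prime_nth_prime[OF pos[OF i]]
            prime_nth_prime[OF pos[OF j]]] by simp
    qed
  qed
  also have "\<dots> = ?m i"
    using finite_prime_index_support[of n] i by (auto simp: sum.delta)
  finally show ?thesis .
qed

lemma nth_prime_dvd_hat_perm_iff:
  assumes "bij_betw \<sigma> {1..} {1..}" "i \<ge> 1" "n \<ge> 1"
  shows "nth_prime (\<sigma> i) dvd hat_perm \<sigma> n \<longleftrightarrow> nth_prime i dvd n"
proof -
  have "\<sigma> i \<ge> 1" using bij_betwE[OF assms(1)] assms(2) by auto
  then show ?thesis
    using multiplicity_hat_perm[OF assms(1,2)] multiplicity_nth_prime_neq_0_iff hat_perm_ge_1 assms
    by metis
qed

lemma hat_perm_id: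
  assumes "n \<ge> 1"
  shows "hat_perm (\<lambda>i. i) n = n"
proof (rule eq_if_prime_multiplicities_eq)
  have id: "bij_betw (\<lambda>i. i) {1..} {1::nat..}" by (simp add: bij_betw_def)
  show "hat_perm (\<lambda>i. i) n \<ge> 1" by (rule hat_perm_ge_1[OF id])
  show "multiplicity (nth_prime i) (hat_perm (\<lambda>i. i) n) = multiplicity (nth_prime i) n"
    if "i \<ge> 1" for i
    by (rule multiplicity_hat_perm[OF id that])
qed (rule assms)

text \<open>
  The right-hand side does not depend on \<open>\<sigma>\<close>; comparison with the identity then shows that
  \<open>hat_perm \<sigma>\<close> preserves \<open>\<Omega>\<close>.
\<close>

lemma Omega_count_hat_perm_eq_sum:
  assumes "bij_betw \<sigma> {1..} {1..}"
  shows "Omega_count (hat_perm \<sigma> n) =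
    (\<Sum>i\<in>{i. i \<ge> 1 \<and> multiplicity (nth_prime i) n \<noteq> 0}. multiplicity (nth_prime i) n)"
proof -
  have pos: "\<sigma> i \<ge> 1" if "i \<ge> 1" for i
    using bij_betwE[OF assms] that by auto
  have "prime_factorization (hat_perm \<sigma> n) =
      (\<Sum>i\<in>{i. i \<ge> 1 \<and> multiplicity (nth_prime i) n \<noteq> 0}.
        prime_factorization (nth_prime (\<sigma> i) ^ multiplicity (nth_prime i) n))"
    unfolding hat_perm_def
    using nth_prime_neq_0[OF pos]
    by (intro prime_factorization_prod finite_prime_index_support) auto
  moreover have "size (prime_factorization (nth_prime (\<sigma> i) ^ k)) = k" if "i \<ge> 1" for i k
    using prime_factorization_prime_power[OF prime_nth_prime[OF pos[OF that]]] by simp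
  ultimately show ?thesis by (simp add: Omega_count_def size_multiset_sum)
qed

lemma Omega_count_hat_perm:
  assumes "bij_betw \<sigma> {1..} {1..}" "n \<ge> 1"
  shows "Omega_count (hat_perm \<sigma> n) = Omega_count n"
proof -
  have "bij_betw (\<lambda>i. i) {1..} {1::nat..}" by (simp add: bij_betw_def)
  from Omega_count_hat_perm_eq_sum[OF this, of n] Omega_count_hat_perm_eq_sum[OF assms(1), of n]
  show ?thesis by (simp only: hat_perm_id[OF assms(2)])
qed

text \<open>
  The inverse is \<open>hat_perm\<close> of the inverse permutation, since both composites preserve all prime
  multiplicities.
\<close>

lemma bij_betw_hat_perm:
  assumes bij: "bij_betw \<sigma> {1..} {1..}"
  shows "bij_betw (hat_perm \<sigma>) {1..} {1..}"
proof -
  define \<tau> where "\<tau> = inv_into {1..} \<sigma>"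
  have \<tau>: "bij_betw \<tau> {1..} {1..}"
    unfolding \<tau>_def using bij by (rule bij_betw_inv_into)
  have \<tau>\<sigma>: "\<tau> (\<sigma> i) = i" if "i \<ge> 1" for i
    using bij_betw_inv_into_left[OF bij] that by (simp add: \<tau>_def)
  have \<sigma>\<tau>: "\<sigma> (\<tau> i) = i" if "i \<ge> 1" for i
    using bij_betw_inv_into_right[OF bij] that by (simp add: \<tau>_def)
  have pos: "\<sigma> i \<ge> 1" "\<tau> i \<ge> 1" if "i \<ge> 1" for i
    using bij_betwE[OF bij] bij_betwE[OF \<tau>] that by auto
  have "hat_perm \<tau> (hat_perm \<sigma> n) = n" if "n \<ge> 1" for n
  proof (rule eq_if_prime_multiplicities_eq[OF hat_perm_ge_1[OF \<tau>] that])
    fix i :: nat assume "i \<ge> 1"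
    then show "multiplicity (nth_prime i) (hat_perm \<tau> (hat_perm \<sigma> n)) = multiplicity (nth_prime i) n"
      using multiplicity_hat_perm[OF \<tau> pos(1)] multiplicity_hat_perm[OF bij] \<tau>\<sigma> by metis
  qed
  moreover have "hat_perm \<sigma> (hat_perm \<tau> n) = n" if "n \<ge> 1" for n
  proof (rule eq_if_prime_multiplicities_eq[OF hat_perm_ge_1[OF bij] that])
    fix i :: nat assume "i \<ge> 1"
    then show "multiplicity (nth_prime i) (hat_perm \<sigma> (hat_perm \<tau> n)) = multiplicity (nth_prime i) n"
      using multiplicity_hat_perm[OF bij pos(2)] multiplicity_hat_perm[OF \<tau>] \<sigma>\<tau> by metis
  qed
  ultimately show ?thesis
    by (intro bij_betwI[where g = "hat_perm \<tau>"]) (auto simp: hat_perm_ge_1[OF bij] hat_perm_ge_1[OF \<tau>] simp del: One_nat_def)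
qed

section \<open>Finite orbits\<close>

lemma bij_betw_of_subgroup:
  assumes "subgroup G S_N" "\<sigma> \<in> G"
  shows "bij_betw \<sigma> {1..} {1..}"
  using subgroup.mem_carrier[OF assms] by (simp add: BijGroup_def Bij_def)

lemma subgroup_orbit_absorb:
  assumes G: "subgroup G S_N" and \<tau>: "\<tau> \<in> G" and i: "i \<ge> 1"
  shows "{\<sigma> (\<tau> i) |\<sigma>. \<sigma> \<in> G} = {\<sigma> i |\<sigma>. \<sigma> \<in> G}"
proof -
  have Bij: "\<sigma> \<in> Bij {1..}" if "\<sigma> \<in> G" for \<sigma>
    using subgroup.mem_carrier[OF G that] by (simp add: BijGroup_def)
  have mult: "(\<sigma> \<otimes>\<^bsub>S_N\<^esub> \<rho>) j = \<sigma> (\<rho> j)" if "\<sigma> \<in> G" "\<rho> \<in> G" "j \<ge> 1" for \<sigma> \<rho> j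
    using Bij[OF that(1)] Bij[OF that(2)] that(3) by (simp add: BijGroup_def compose_def)
  have inv_G: "inv\<^bsub>S_N\<^esub> \<tau> \<in> G"
    using subgroup.m_inv_closed[OF G \<tau>] .
  have "inv\<^bsub>S_N\<^esub> \<tau> \<otimes>\<^bsub>S_N\<^esub> \<tau> = \<one>\<^bsub>S_N\<^esub>"
    by (rule group.l_inv[OF group_BijGroup subgroup.mem_carrier[OF G \<tau>]])
  then have inv_\<tau>: "(inv\<^bsub>S_N\<^esub> \<tau>) (\<tau> i) = i"
    using mult[OF inv_G \<tau> i] i by (simp add: BijGroup_def)
  have \<tau>i: "\<tau> i \<ge> 1"
    using bij_betwE[OF bij_betw_of_subgroup[OF G \<tau>]] i by auto
  show ?thesis
  proof (intro equalityI subsetI)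
    fix x assume "x \<in> {\<sigma> (\<tau> i) |\<sigma>. \<sigma> \<in> G}"
    then obtain \<sigma> where \<sigma>: "\<sigma> \<in> G" "x = \<sigma> (\<tau> i)" by blast
    then have "x = (\<sigma> \<otimes>\<^bsub>S_N\<^esub> \<tau>) i" using mult[OF \<sigma>(1) \<tau> i] by simp
    then show "x \<in> {\<sigma> i |\<sigma>. \<sigma> \<in> G}"
      using subgroup.m_closed[OF G \<sigma>(1) \<tau>] by blast
  next
    fix x assume "x \<in> {\<sigma> i |\<sigma>. \<sigma> \<in> G}"
    then obtain \<sigma> where \<sigma>: "\<sigma> \<in> G" "x = \<sigma> i" by blast
    then have "x = (\<sigma> \<otimes>\<^bsub>S_N\<^esub> inv\<^bsub>S_N\<^esub> \<tau>) (\<tau> i)"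
      using mult[OF \<sigma>(1) inv_G \<tau>i] inv_\<tau> by simp
    then show "x \<in> {\<sigma> (\<tau> i) |\<sigma>. \<sigma> \<in> G}"
      using subgroup.m_closed[OF G \<sigma>(1) inv_G] by blast
  qed
qed

text \<open>
  A point that lies in some finite orbit has that orbit as its own.
\<close>

lemma finite_orbit_points_iff:
  assumes G: "subgroup G S_N"
  shows "i \<in> finite_orbit_points G \<longleftrightarrow> i \<ge> 1 \<and> finite {\<sigma> i |\<sigma>. \<sigma> \<in> G}"
proof
  assume "i \<in> finite_orbit_points G"
  then obtain j \<tau> where j: "j \<ge> 1" "finite {\<sigma> j |\<sigma>. \<sigma> \<in> G}" and \<tau>: "\<tau> \<in> G" "i = \<tau> j"
    by (auto simp: finite_orbit_points_def orbits_def orbit_def)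
  moreover have "\<tau> j \<ge> 1"
    using bij_betwE[OF bij_betw_of_subgroup[OF G \<tau>(1)]] j by auto
  ultimately show "i \<ge> 1 \<and> finite {\<sigma> i |\<sigma>. \<sigma> \<in> G}"
    using subgroup_orbit_absorb[OF G \<tau>(1) j(1)] by simp
next
  assume i: "i \<ge> 1 \<and> finite {\<sigma> i |\<sigma>. \<sigma> \<in> G}"
  have "\<one>\<^bsub>S_N\<^esub> \<in> G" "\<one>\<^bsub>S_N\<^esub> i = i"
    using subgroup.one_closed[OF G] i by (auto simp: BijGroup_def)
  then have "i \<in> {\<sigma> i |\<sigma>. \<sigma> \<in> G}"
    by (metis (mono_tags, lifting) mem_Collect_eq)
  with i show "i \<in> finite_orbit_points G"
    by (auto simp: finite_orbit_points_def orbits_def orbit_def)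
qed

lemma finite_orbit_points_perm_iff:
  assumes "subgroup G S_N" "\<sigma> \<in> G" "i \<ge> 1"
  shows "\<sigma> i \<in> finite_orbit_points G \<longleftrightarrow> i \<in> finite_orbit_points G"
  using bij_betwE[OF bij_betw_of_subgroup[OF assms(1,2)]] assms
  by (simp add: finite_orbit_points_iff subgroup_orbit_absorb)

text \<open>
  For the converse direction, \<open>n\<close> is the product of its prime powers, which is
  \<open>hat_perm\<close> of the identity.
\<close>

lemma N_O_iff:
  assumes G: "subgroup G S_N"
  shows "n \<in> N_O G \<longleftrightarrow>
    n \<ge> 1 \<and> (\<forall>i\<ge>1. nth_prime i dvd n \<longrightarrow> i \<in> finite_orbit_points G)"
proof
  assume "n \<in> N_O G"
  then show "n \<ge> 1 \<and> (\<forall>i\<ge>1. nth_prime i dvd n \<longrightarrow> i \<in> finite_orbit_points G)"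
    unfolding N_O_def
  proof induction
    case one
    then show ?case by (metis le_numeral_extra(4) prime_nth_prime not_prime_unit)
  next
    case (gen x)
    then obtain j where j: "j \<in> finite_orbit_points G" "x = nth_prime j" by blast
    then have "j \<ge> 1" by (simp add: finite_orbit_points_iff[OF G])
    with j show ?case
      by (metis nth_prime_eq_iff prime_nth_prime primes_dvd_imp_eq prime_ge_1_nat)
  next
    case (mult x y)
    then show ?case
      using prime_dvd_mult_iff[OF prime_nth_prime] by fastforce
  qed
next
  assume n: "n \<ge> 1 \<and> (\<forall>i\<ge>1. nth_prime i dvd n \<longrightarrow> i \<in> finite_orbit_points G)"
  have power: "x ^ k \<in> N_O G" if "x \<in> N_O G" for x k
    by (induction k) (use that in \<open>auto simp: N_O_def intro: unital_semigroup_gen.intros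
          unital_semigroup_gen.one[simplified]\<close>)
  have product: "prod u I \<in> N_O G" if "finite I" "\<And>i. i \<in> I \<Longrightarrow> u i \<in> N_O G" for I :: "nat set" and u
    using that
    by (induction rule: finite_induct) (auto simp: N_O_def intro: unital_semigroup_gen.intros
          unital_semigroup_gen.one[simplified])
  have "nth_prime i \<in> N_O G" if "i \<ge> 1" "multiplicity (nth_prime i) n \<noteq> 0" for i
    using that n multiplicity_nth_prime_neq_0_iff[of i n] unfolding N_O_def
    by (auto intro: unital_semigroup_gen.gen)
  then have "hat_perm (\<lambda>i. i) n \<in> N_O G"
    unfolding hat_perm_def by (intro product power finite_prime_index_support) auto
  with n show "n \<in> N_O G" by (simp add: hat_perm_id)
qed

lemma hat_perm_in_N_O_iff:
  assumes G: "subgroup G S_N" and \<sigma>: "\<sigma> \<in> G" and n: "n \<ge> 1"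
  shows "hat_perm \<sigma> n \<in> N_O G \<longleftrightarrow> n \<in> N_O G"
proof -
  have bij: "bij_betw \<sigma> {1..} {1..}" using bij_betw_of_subgroup[OF G \<sigma>] .
  have "(\<forall>j\<ge>1. nth_prime j dvd hat_perm \<sigma> n \<longrightarrow> j \<in> finite_orbit_points G) \<longleftrightarrow>
      (\<forall>j\<in>\<sigma> ` {1..}. nth_prime j dvd hat_perm \<sigma> n \<longrightarrow> j \<in> finite_orbit_points G)"
    unfolding bij_betw_imp_surj_on[OF bij] by auto
  also have "\<dots> \<longleftrightarrow> (\<forall>i\<ge>1. nth_prime i dvd n \<longrightarrow> i \<in> finite_orbit_points G)"
    using nth_prime_dvd_hat_perm_iff[OF bij _ n] finite_orbit_points_perm_iff[OF G \<sigma>] by auto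
  finally show ?thesis
    using hat_perm_ge_1[OF bij] n by (simp add: N_O_iff[OF G])
qed

text \<open>
  Some prime index \<open>i\<close> of \<open>n\<close> has an infinite orbit. Every \<open>\<sigma> i\<close> is a prime index of \<open>hat_perm \<sigma> n\<close>, and
  finitely many positive integers have only finitely many prime factors between them.
\<close>

lemma infinite_hat_orbit:
  assumes G: "subgroup G S_N" and n: "n \<ge> 1" "n \<notin> N_O G"
  shows "infinite {hat_perm \<sigma> n |\<sigma>. \<sigma> \<in> G}"
proof
  assume fin: "finite {hat_perm \<sigma> n |\<sigma>. \<sigma> \<in> G}"
  obtain i where i: "i \<ge> 1" "nth_prime i dvd n" "i \<notin> finite_orbit_points G"
    using n by (auto simp: N_O_iff[OF G])
  have pos: "\<sigma> i \<ge> 1" if "\<sigma> \<in> G" for \<sigma>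
    using bij_betwE[OF bij_betw_of_subgroup[OF G that]] i by auto
  have "nth_prime ` {\<sigma> i |\<sigma>. \<sigma> \<in> G} \<subseteq> (\<Union>m\<in>{hat_perm \<sigma> n |\<sigma>. \<sigma> \<in> G}. {d. d dvd m})"
    using nth_prime_dvd_hat_perm_iff[OF bij_betw_of_subgroup[OF G] i(1) n(1)] i(2) by blast
  moreover have "finite (\<Union>m\<in>{hat_perm \<sigma> n |\<sigma>. \<sigma> \<in> G}. {d. d dvd m})"
  proof (rule finite_UN_I[OF fin])
    fix m assume "m \<in> {hat_perm \<sigma> n |\<sigma>. \<sigma> \<in> G}"
    then have "m \<ge> 1"
      using hat_perm_ge_1[OF bij_betw_of_subgroup[OF G]] by blast
    then show "finite {d. d dvd m}" by (intro finite_divisors_nat) simp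
  qed
  moreover have "inj_on nth_prime {\<sigma> i |\<sigma>. \<sigma> \<in> G}"
    by (intro inj_onI) (use pos in \<open>auto simp: nth_prime_eq_iff simp del: One_nat_def\<close>)
  ultimately have "finite {\<sigma> i |\<sigma>. \<sigma> \<in> G}"
    by (meson finite_imageD finite_subset)
  with i show False by (simp add: finite_orbit_points_iff[OF G])
qed

section \<open>Invariant Dirichlet series\<close>

text \<open>
  Substituting \<open>hat_perm \<sigma> n\<close> for \<open>n\<close> removes the inverse from the definition of \<open>S_perm\<close>.
\<close>

lemma S_perm_invariant_iff:
  assumes "bij_betw \<sigma> {1..} {1..}"
  shows "(\<forall>n\<ge>1. S_perm \<sigma> a n = a n) \<longleftrightarrow> (\<forall>n\<ge>1. a (hat_perm \<sigma> n) = a n)"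
proof -
  have bij: "bij_betw (hat_perm \<sigma>) {1..} {1..}"
    using assms by (rule bij_betw_hat_perm)
  have "(\<forall>n\<in>{1..}. S_perm \<sigma> a n = a n) \<longleftrightarrow>
      (\<forall>n\<in>hat_perm \<sigma> ` {1..}. S_perm \<sigma> a n = a n)"
    by (simp only: bij_betw_imp_surj_on[OF bij])
  also have "\<dots> \<longleftrightarrow> (\<forall>n\<in>{1..}. a n = a (hat_perm \<sigma> n))"
    using bij_betw_inv_into_left[OF bij] by (simp add: S_perm_def)
  finally show ?thesis by auto
qed

lemma O_b_inv_iff:
  assumes G: "subgroup G S_N" and "f \<in> O_b" and a: "is_limit_function a f"
  shows "f \<in> O_b_inv G \<longleftrightarrow> (\<forall>\<sigma>\<in>G. \<forall>n\<ge>1. a (hat_perm \<sigma> n) = a n)"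
proof
  assume "f \<in> O_b_inv G"
  then obtain b where b: "is_limit_function b f" "\<forall>\<sigma>\<in>G. \<forall>n\<ge>1. S_perm \<sigma> b n = b n"
    by (auto simp: O_b_inv_def)
  show "\<forall>\<sigma>\<in>G. \<forall>n\<ge>1. a (hat_perm \<sigma> n) = a n"
  proof (intro ballI allI impI)
    fix \<sigma> and n :: nat assume *: "\<sigma> \<in> G" "n \<ge> 1"
    note bij = bij_betw_of_subgroup[OF G *(1)]
    have "b (hat_perm \<sigma> n) = b n"
      using S_perm_invariant_iff[OF bij] b(2) * by blast
    then show "a (hat_perm \<sigma> n) = a n"
      using is_limit_function_unique_coeffs[OF a b(1)] hat_perm_ge_1[OF bij] * by metis
  qed
next
  assume "\<forall>\<sigma>\<in>G. \<forall>n\<ge>1. a (hat_perm \<sigma> n) = a n"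
  then show "f \<in> O_b_inv G"
    using S_perm_invariant_iff[OF bij_betw_of_subgroup[OF G]] assms unfolding O_b_inv_def by blast
qed

text \<open>
  The coefficient of the bounded function \<open>f\<^sub>r\<close> at \<open>n\<close> recurs at each of the infinitely many images
  of \<open>n\<close>, against square summability.
\<close>

lemma invariant_coeff_eq_0:
  assumes G: "subgroup G S_N" and f: "f \<in> O_b" and a: "is_limit_function a f"
    and invariant: "\<And>\<sigma>. \<sigma> \<in> G \<Longrightarrow> a (hat_perm \<sigma> n) = a n"
    and n: "n \<ge> 1" "n \<notin> N_O G"
  shows "a n = 0"
proof -
  \<comment> \<open>Any radius in \<open>(0, 1)\<close> would do in place of \<open>1/2\<close>.\<close>
  define b where "b = radial_coeffs (1/2) a"
  define X where "X = {hat_perm \<sigma> n |\<sigma>. \<sigma> \<in> G}"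
  obtain g where g: "is_limit_function b g" "bounded (g ` half_plane 0)"
    using O_b_radial_bounded[OF f a, of "1/2"] unfolding b_def by auto
  then obtain M where M: "\<And>s. s \<in> half_plane 0 \<Longrightarrow> cmod (g s) \<le> M"
    by (auto simp: bounded_iff)
  have const: "b m = b n" "m \<ge> 1" if "m \<in> X" for m
  proof -
    from that obtain \<sigma> where \<sigma>: "\<sigma> \<in> G" "m = hat_perm \<sigma> n" by (auto simp: X_def)
    note bij = bij_betw_of_subgroup[OF G \<sigma>(1)]
    show "b m = b n" "m \<ge> 1"
      using \<sigma> invariant[OF \<sigma>(1)] Omega_count_hat_perm[OF bij n(1)] hat_perm_ge_1[OF bij]
      by (simp_all add: b_def radial_coeffs_def)
  qed
  have bessel: "real k * (cmod (b n))\<^sup>2 \<le> M\<^sup>2" for k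
  proof -
    obtain F where F: "F \<subseteq> X" "finite F" "card F = k"
      using infinite_arbitrarily_large[OF infinite_hat_orbit[OF G n]] unfolding X_def by blast
    have "(\<Sum>m\<in>F. (cmod (b m))\<^sup>2) \<le> M\<^sup>2"
      using F const by (intro dirichlet_series_bessel[OF g(1) M]) auto
    moreover have "(\<Sum>m\<in>F. (cmod (b m))\<^sup>2) = real k * (cmod (b n))\<^sup>2"
      using F const by (subst sum.cong[OF refl, of F _ "\<lambda>_. (cmod (b n))\<^sup>2"]) auto
    ultimately show ?thesis by simp
  qed
  have "b n = 0"
  proof (rule ccontr)
    assume "b n \<noteq> 0"
    then obtain k :: nat where "M\<^sup>2 < real k * (cmod (b n))\<^sup>2"
      using reals_Archimedean3[of "(cmod (b n))\<^sup>2"] by auto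
    with bessel[of k] show False by simp
  qed
  then show ?thesis by (simp add: b_def radial_coeffs_def)
qed

theorem theorem2p6:
  fixes G :: "(nat \<Rightarrow> nat) set" and a :: "nat \<Rightarrow> complex" and f :: "complex \<Rightarrow> complex"
  assumes "subgroup G S_N"
    and "a \<in> D_O_b"
    and "is_limit_function a f"
  shows "f \<in> O_b_inv G \<longleftrightarrow>
    (\<forall>n\<in>{1..} - N_O G. a n = 0) \<and>
    (\<forall>n\<in>N_O G. \<forall>\<sigma>\<in>G. a (hat_perm \<sigma> n) = a n)"
proof -
  note G = assms(1) and a = assms(3)
  have f: "f \<in> O_b"
    using limit_function_of_D_O_b_in_O_b[OF assms(2,3)] .
  note inv_iff = O_b_inv_iff[OF G f a]
  show ?thesis
  proof
    assume "f \<in> O_b_inv G"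
    then have "a (hat_perm \<sigma> n) = a n" if "\<sigma> \<in> G" "n \<ge> 1" for \<sigma> n
      using that inv_iff by blast
    then show "(\<forall>n\<in>{1..} - N_O G. a n = 0) \<and>
        (\<forall>n\<in>N_O G. \<forall>\<sigma>\<in>G. a (hat_perm \<sigma> n) = a n)"
      using invariant_coeff_eq_0[OF G f a] by (auto simp: N_O_iff[OF G])
  next
    assume coeffs: "(\<forall>n\<in>{1..} - N_O G. a n = 0) \<and>
        (\<forall>n\<in>N_O G. \<forall>\<sigma>\<in>G. a (hat_perm \<sigma> n) = a n)"
    have "a (hat_perm \<sigma> n) = a n" if "\<sigma> \<in> G" "n \<ge> 1" for \<sigma> n
    proof (cases "n \<in> N_O G")
      case False
      then have "hat_perm \<sigma> n \<in> {1..} - N_O G" "n \<in> {1..} - N_O G"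
        using hat_perm_in_N_O_iff[OF G that] hat_perm_ge_1[OF bij_betw_of_subgroup[OF G that(1)]]
          that(2) by auto
      with coeffs show ?thesis by metis
    qed (use coeffs that in blast)
    then show "f \<in> O_b_inv G" using inv_iff by blast
  qed
qed

end
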